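(* For the jet conformal Minkowski metric $F$, the energy action functional $$\mathbb{E}(t,x(t))=\int_a^bF^2(t,x,y)\sqrt{h_{11}}\,dt=\int_a^be^{2\sigma(x)}\left(y_1^1y_1^2+y_1^1y_1^3+y_1^1y_1^4+y_1^2y_1^3+y_1^2y_1^4+y_1^3y_1^4\right)h^{11}(t)\sqrt{h_{11}(t)}\,dt,$$ where $y=dx/dt$, produces on the 1-jet space $J^1(\mathbb{R},M^4)$ the canonical nonlinear connection $$\Gamma=\left(M_{(1)1}^{(i)}=-\varkappa_{11}^1y_1^i,\ N_{(1)j}^{(i)}\right),$$ where $$N_{(1)j}^{(i)}=\sigma_jy_1^i+\sigma_my_1^m\,\delta_j^i+\left[\sigma_i-\frac13\operatorname{div}D_\sigma\right]\left(S_{[1]1}-y_1^j\right).$$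
   Context: $h_{11}(t)>0$ is a smooth Riemannian metric on $\mathbb{R}$, $h^{11}=1/h_{11}$, and $\varkappa_{11}^1=\frac{h^{11}}{2}\frac{dh_{11}}{dt}$ is its Christoffel symbol. $M^4$ is a smooth 4-manifold with local coordinates $x=(x^1,\dots,x^4)$, and $\sigma$ is a smooth non-constant function on $M^4$, with $\sigma_i=\partial\sigma/\partial x^i$. The 1-jet space $J^1(\mathbb{R},M^4)$ has local coordinates $(t,x,y)$, $y=(y_1^1,\dots,y_1^4)$. The jet conformal Minkowski metric is $F(t,x,y)=e^{\sigma(x)}\sqrt{h^{11}(t)}\sqrt{G_{11}(y)}$ with $G_{11}(y)=y_1^1y_1^2+y_1^1y_1^3+y_1^1y_1^4+y_1^2y_1^3+y_1^2y_1^4+y_1^3y_1^4$, on the domain $G_{11}(y)>0$. Latin indices run from 1 to 4, the Einstein summation convention is used for an index repeated in upper and lower position, and $\delta^i_j$ is the Kronecker symbol. Notation: $S_{[1]1}=y_1^1+y_1^2+y_1^3+y_1^4$ and $\operatorname{div}D_\sigma=\sigma_1+\sigma_2+\sigma_3+\sigma_4$. Canonical nonlinear connection: let $g_{ij}=\frac{h_{11}}{2}\frac{\partial^2F^2}{\partial y_1^i\partial y_1^j}$ with inverse matrix $(g^{ij})$. The Euler–Lagrange equations of $\mathbb{E}$ can be written as $$\frac{d^2x^i}{dt^2}+2H_{(1)1}^{(i)}(t,x,y)+2G_{(1)1}^{(i)}(t,x,y)=0,\qquad y_1^k=\frac{dx^k}{dt},$$ where $$H_{(1)1}^{(i)}=-\frac12\varkappa_{11}^1y_1^i,\qquad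 G_{(1)1}^{(i)}=\frac{h_{11}g^{ik}}{4}\left[\frac{\partial^2F^2}{\partial x^m\partial y_1^k}y_1^m-\frac{\partial F^2}{\partial x^k}+\frac{\partial^2F^2}{\partial t\,\partial y_1^k}+\frac{\partial F^2}{\partial y_1^k}\varkappa_{11}^1+2h^{11}\varkappa_{11}^1g_{km}y_1^m\right].$$ The canonical nonlinear connection produced by $\mathbb{E}$ is the pair of local components $M_{(1)1}^{(i)}=2H_{(1)1}^{(i)}$ and $N_{(1)j}^{(i)}=\partial G_{(1)1}^{(i)}/\partial y_1^j$. *)

theory Defs
  imports "HOL-Analysis.Analysis"
begin

section \<open>Smoothness and smooth manifolds\<close>

text \<open>For open \<open>S\<close> in a finite-dimensional space this is the class \<open>C^k\<close>: continuity for \<open>k = 0\<close>,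
  and in the step every directional derivative \<open>x \<mapsto> Df(x) v\<close> is required to be \<open>C^k\<close>.\<close>

primrec Ck_on :: "nat \<Rightarrow> 'a::real_normed_vector set \<Rightarrow> ('a \<Rightarrow> 'b::real_normed_vector) \<Rightarrow> bool" where
  "Ck_on 0 S f \<longleftrightarrow> continuous_on S f"
| "Ck_on (Suc k) S f \<longleftrightarrow>
     (\<forall>x\<in>S. f differentiable (at x)) \<and> (\<forall>v. Ck_on k S (\<lambda>x. frechet_derivative f (at x) v))"

definition smooth_on :: "'a::real_normed_vector set \<Rightarrow> ('a \<Rightarrow> 'b::real_normed_vector) \<Rightarrow> bool" where
  "smooth_on S f \<longleftrightarrow> (\<forall>k. Ck_on k S f)"

type_synonym ('m, 'n) chart = "'m set \<times> ('m \<Rightarrow> real ^ 'n)"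

definition is_chart :: "'m topology \<Rightarrow> ('m, 'n::finite) chart \<Rightarrow> bool" where
  "is_chart M = (\<lambda>(U, \<phi>). openin M U \<and> open (\<phi> ` U) \<and>
     homeomorphic_map (subtopology M U) (top_of_set (\<phi> ` U)) \<phi>)"

text \<open>The atlas is not required to be maximal. The dimension is \<open>CARD('n)\<close>.\<close>

definition smooth_manifold :: "'m topology \<Rightarrow> ('m, 'n::finite) chart set \<Rightarrow> bool" where
  "smooth_manifold M A \<longleftrightarrow>
     Hausdorff_space M \<and> second_countable M \<and>
     (\<forall>c\<in>A. is_chart M c) \<and> (\<Union>(U, \<phi>)\<in>A. U) = topspace M \<and>
     (\<forall>(U, \<phi>)\<in>A. \<forall>(V, \<psi>)\<in>A. smooth_on (\<phi> ` (U \<inter> V)) (\<psi> \<circ> inv_into U \<phi>))"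

definition local_expr :: "('m, 'n::finite) chart \<Rightarrow> ('m \<Rightarrow> real) \<Rightarrow> real ^ 'n \<Rightarrow> real" where
  "local_expr = (\<lambda>(U, \<phi>) f. f \<circ> inv_into U \<phi>)"

definition smooth_function :: "('m, 'n::finite) chart set \<Rightarrow> ('m \<Rightarrow> real) \<Rightarrow> bool" where
  "smooth_function A f \<longleftrightarrow> (\<forall>c\<in>A. smooth_on (snd c ` fst c) (local_expr c f))"

section \<open>Jet Finsler-like metrics in local coordinates\<close>

text \<open>A metric is given by its local expression \<open>F t x y\<close> on the 1-jet space over a chart domain:
  \<open>t\<close> is the coordinate on the time axis, \<open>x\<close> that on the manifold and \<open>y\<close> the velocity
  coordinate.  \<open>h t\<close> stands for the component \<open>h_11(t)\<close>, so that \<open>h^11 = 1 / h_11\<close>.\<close>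

type_synonym 'n jet_fun = "real \<Rightarrow> real ^ 'n \<Rightarrow> real ^ 'n \<Rightarrow> real"

definition pd :: "'n::finite \<Rightarrow> (real ^ 'n \<Rightarrow> real) \<Rightarrow> real ^ 'n \<Rightarrow> real" where
  "pd i f x = deriv (\<lambda>s. f (x + s *\<^sub>R axis i 1)) 0"

definition christoffel :: "(real \<Rightarrow> real) \<Rightarrow> real \<Rightarrow> real" where
  "christoffel h t = (1 / h t) / 2 * deriv h t"

definition fund_tensor :: "(real \<Rightarrow> real) \<Rightarrow> 'n jet_fun \<Rightarrow> real \<Rightarrow> real ^ 'n \<Rightarrow> real ^ 'n \<Rightarrow> real ^ 'n ^ 'n::finite" where
  "fund_tensor h F t x y =
     (\<chi> i j. h t / 2 * pd i (\<lambda>y'. pd j (\<lambda>y''. (F t x y'')\<^sup>2) y') y)"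

subsection \<open>Energy and Euler-Lagrange equations\<close>

definition velocity :: "(real \<Rightarrow> real ^ 'n) \<Rightarrow> real \<Rightarrow> real ^ 'n::finite" where
  "velocity c t = vector_derivative c (at t)"

definition acceleration :: "(real \<Rightarrow> real ^ 'n) \<Rightarrow> real \<Rightarrow> real ^ 'n::finite" where
  "acceleration c t = vector_derivative (velocity c) (at t)"

definition energy_lagrangian :: "(real \<Rightarrow> real) \<Rightarrow> 'n jet_fun \<Rightarrow> 'n::finite jet_fun" where
  "energy_lagrangian h F t x y = (F t x y)\<^sup>2 * sqrt (h t)"

definition energy :: "(real \<Rightarrow> real) \<Rightarrow> 'n jet_fun \<Rightarrow> real \<Rightarrow> real \<Rightarrow> (real \<Rightarrow> real ^ 'n::finite) \<Rightarrow> real" where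
  "energy h F a b c = integral {a..b} (\<lambda>t. energy_lagrangian h F t (c t) (velocity c t))"

definition euler_lagrange_at :: "'n jet_fun \<Rightarrow> (real \<Rightarrow> real ^ 'n::finite) \<Rightarrow> real \<Rightarrow> bool" where
  "euler_lagrange_at L c t \<longleftrightarrow>
     (\<forall>k. deriv (\<lambda>s. pd k (\<lambda>y. L s (c s) y) (velocity c s)) t
          - pd k (\<lambda>x. L t x (velocity c t)) (c t) = 0)"

subsection \<open>Semisprays and the canonical nonlinear connection\<close>

definition temporal_spray :: "(real \<Rightarrow> real) \<Rightarrow> real \<Rightarrow> real ^ 'n \<Rightarrow> real ^ 'n \<Rightarrow> real ^ 'n::finite" where
  "temporal_spray h t x y = (\<chi> i. - (1 / 2) * christoffel h t * y $ i)"

definition spatial_spray :: "(real \<Rightarrow> real) \<Rightarrow> 'n jet_fun \<Rightarrow> real \<Rightarrow> real ^ 'n \<Rightarrow> real ^ 'n \<Rightarrow> real ^ 'n::finite" where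
  "spatial_spray h F t x y = (\<chi> i. \<Sum>k\<in>UNIV.
     h t * matrix_inv (fund_tensor h F t x y) $ i $ k / 4 *
     ((\<Sum>m\<in>UNIV. pd m (\<lambda>x'. pd k (\<lambda>y'. (F t x' y')\<^sup>2) y) x * y $ m)
      - pd k (\<lambda>x'. (F t x' y)\<^sup>2) x
      + deriv (\<lambda>t'. pd k (\<lambda>y'. (F t' x y')\<^sup>2) y) t
      + pd k (\<lambda>y'. (F t x y')\<^sup>2) y * christoffel h t
      + 2 * (1 / h t) * christoffel h t * (\<Sum>m\<in>UNIV. fund_tensor h F t x y $ k $ m * y $ m)))"

text \<open>The pair \<open>(M, N)\<close> with \<open>M $ i = M_(1)1^(i)\<close> and \<open>N $ i $ j = N_(1)j^(i)\<close>.\<close>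

definition canonical_connection ::
    "(real \<Rightarrow> real) \<Rightarrow> 'n jet_fun \<Rightarrow> real \<Rightarrow> real ^ 'n \<Rightarrow> real ^ 'n \<Rightarrow> (real ^ 'n) \<times> (real ^ 'n ^ 'n::finite)" where
  "canonical_connection h F t x y =
     ((\<chi> i. 2 * temporal_spray h t x y $ i),
      (\<chi> i j. pd j (\<lambda>y'. spatial_spray h F t x y' $ i) y))"

section \<open>The jet conformal Minkowski metric\<close>

definition G11 :: "real ^ 4 \<Rightarrow> real" where
  "G11 y = y $ 1 * y $ 2 + y $ 1 * y $ 3 + y $ 1 * y $ 4 + y $ 2 * y $ 3 + y $ 2 * y $ 4 + y $ 3 * y $ 4"

text \<open>Meaningful only for \<open>G11 y > 0\<close>, since \<open>sqrt\<close> is extended to negative reals as an odd function.\<close>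

definition conformal_minkowski :: "(real \<Rightarrow> real) \<Rightarrow> (real ^ 4 \<Rightarrow> real) \<Rightarrow> 4 jet_fun" where
  "conformal_minkowski h \<sigma> t x y = exp (\<sigma> x) * sqrt (1 / h t) * sqrt (G11 y)"

definition S1 :: "real ^ 4 \<Rightarrow> real" where
  "S1 y = y $ 1 + y $ 2 + y $ 3 + y $ 4"

definition divD :: "(real ^ 4 \<Rightarrow> real) \<Rightarrow> real ^ 4 \<Rightarrow> real" where
  "divD \<sigma> x = pd 1 \<sigma> x + pd 2 \<sigma> x + pd 3 \<sigma> x + pd 4 \<sigma> x"

end

(* Where G_11 > 0 the square of F is e^(2 sigma) h^11 G_11, a conformal multiple of a quadratic
   form whose Hessian J - I (J the all-ones matrix) has inverse J/3 - I.  In the spatial spray the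
   three terms carrying the Christoffel symbol cancel, leaving
   sigma_m y^m y^i + (sigma_i - div/3) G_11, and N is its y-gradient.  The Euler-Lagrange
   expression is a positive multiple of J - I applied to x'' + 2H + 2G, so the two equations
   have the same solutions. *)

theory Submission
  imports Defs
begin

section \<open>Partial derivatives\<close>

lemma DERIV_along_line:
  fixes f :: "'a::real_normed_vector \<Rightarrow> real"
  assumes "(f has_derivative f') (at x)"
  shows "((\<lambda>r. f (x + r *\<^sub>R v)) has_real_derivative f' v) (at 0)"
proof -
  have "((\<lambda>r::real. x + r *\<^sub>R v) has_derivative (\<lambda>r. r *\<^sub>R v)) (at 0)"
    by (auto intro!: derivative_eq_intros)
  moreover have "(f has_derivative f') (at (x + 0 *\<^sub>R v))"
    using assms by simp
  ultimately have "((\<lambda>r. f (x + r *\<^sub>R v)) has_derivative (\<lambda>r. f' (r *\<^sub>R v))) (at 0)"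
    by (rule has_derivative_compose)
  moreover have "(\<lambda>r. f' (r *\<^sub>R v)) = (*) (f' v)"
    using has_derivative_bounded_linear[OF assms]
    by (auto simp: linear_simps mult.commute)
  ultimately show ?thesis
    by (simp add: has_field_derivative_def)
qed

lemma sum_mult_axis:
  fixes f :: "'n::finite \<Rightarrow> 'a::semiring_1"
  shows "(\<Sum>m\<in>UNIV. f m * axis k 1 $ m) = f k"
  by (simp add: axis_def if_distrib[of "(*) _"] cong: if_cong)

lemma pd_eq:
  assumes "(f has_derivative f') (at x)"
  shows "pd i f x = f' (axis i 1)"
  unfolding pd_def by (rule DERIV_imp_deriv[OF DERIV_along_line[OF assms]])

text \<open>Linearity of the derivative and expansion of \<open>v\<close> in the standard basis give
  the gradient form. It feeds the chain rule for \<open>exp (2 * s x)\<close> and for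
  \<open>s\<close> along a curve; \<open>sum_mult_axis\<close> then picks out single
  coefficients.\<close>

lemma has_derivative_pd:
  fixes f :: "real ^ 'n::finite \<Rightarrow> real"
  assumes "f differentiable (at x)"
  shows "(f has_derivative (\<lambda>v. \<Sum>m\<in>UNIV. pd m f x * v $ m)) (at x)"
proof -
  obtain f' where f': "(f has_derivative f') (at x)"
    using assms by (auto simp: differentiable_def)
  have "f' v = (\<Sum>m\<in>UNIV. pd m f x * v $ m)" for v
  proof -
    have "f' v = f' (\<Sum>m\<in>UNIV. (v $ m) *\<^sub>R axis m 1)"
      by (simp add: basis_expansion flip: scalar_mult_eq_scaleR)
    also have "\<dots> = (\<Sum>m\<in>UNIV. pd m f x * v $ m)"
      using has_derivative_linear[OF f']
      by (simp add: linear_sum linear_scale pd_eq[OF f'] mult.commute)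
    finally show ?thesis .
  qed
  then have "f' = (\<lambda>v. \<Sum>m\<in>UNIV. pd m f x * v $ m)" by auto
  with f' show ?thesis by simp
qed

text \<open>The closed form of F^2 is available only on the cone \<open>G11 y > 0\<close>. The cone
  is open, so short coordinate segments stay inside it and partial derivatives see only the closed
  form.\<close>

lemma pd_cong_open:
  assumes "open S" "x \<in> S" "\<And>z. z \<in> S \<Longrightarrow> f z = g z"
  shows "pd i f x = pd i g x"
  unfolding pd_def
proof (rule deriv_cong_ev)
  have "((\<lambda>r::real. x + r *\<^sub>R axis i 1) \<longlongrightarrow> x + 0 *\<^sub>R axis i 1) (nhds 0)"
    by (intro tendsto_intros filterlim_ident)
  then have "\<forall>\<^sub>F r in nhds 0. x + r *\<^sub>R axis i 1 \<in> S"
    using assms(1,2) by (auto dest: topological_tendstoD)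
  then show "\<forall>\<^sub>F r in nhds 0. f (x + r *\<^sub>R axis i 1) = g (x + r *\<^sub>R axis i 1)"
    by eventually_elim (rule assms(3))
qed simp

text \<open>\<open>matrix_inv\<close> is a choice; a one-sided inverse of a square matrix is
  two-sided and hence the only candidate.\<close>

lemma matrix_inv_eqI:
  fixes A B :: "'a::field ^ 'n::finite ^ 'n"
  assumes "A ** B = mat 1"
  shows "matrix_inv A = B"
proof -
  have BA: "B ** A = mat 1"
    using assms matrix_left_right_inverse by blast
  have "A ** matrix_inv A = mat 1 \<and> matrix_inv A ** A = mat 1"
    unfolding matrix_inv_def by (rule someI[of _ B]) (simp add: assms BA)
  then have "matrix_inv A = (B ** A) ** matrix_inv A"
    by (simp add: BA)
  also have "\<dots> = B"
    using \<open>A ** matrix_inv A = mat 1 \<and> _\<close> by (simp flip: matrix_mul_assoc)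
  finally show ?thesis .
qed

lemma pd_cmult:
  assumes "f differentiable (at x)"
  shows "pd i (\<lambda>z. C * f z) x = C * pd i f x"
proof -
  obtain f' where f': "(f has_derivative f') (at x)"
    using assms by (auto simp: differentiable_def)
  show ?thesis
    by (simp add: pd_eq[OF f'] pd_eq[OF has_derivative_mult_right[OF f', of C]])
qed

lemma pd_exp:
  assumes "s differentiable (at x)"
  shows "pd m (\<lambda>x. exp (2 * s x) * C) x = 2 * exp (2 * s x) * pd m s x * C"
proof -
  have "((\<lambda>x. exp (2 * s x) * C) has_derivative
      (\<lambda>v. 2 * exp (2 * s x) * (\<Sum>m\<in>UNIV. pd m s x * v $ m) * C)) (at x)"
    by (auto intro!: derivative_eq_intros has_derivative_pd[OF assms])
  from pd_eq[OF this] show ?thesis by (simp add: sum_mult_axis)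
qed

section \<open>The quadratic form\<close>

lemma vec_nth_has_derivative: "((\<lambda>y. y $ i) has_derivative (\<lambda>d. d $ i)) F"
  by (rule bounded_linear_imp_has_derivative[OF bounded_linear_vec_nth])

text \<open>In the sum of all products of two distinct coordinates, the cofactor of
  \<open>y $ k\<close> is the sum of the other coordinates.\<close>

lemma G11_has_derivative:
  "(G11 has_derivative (\<lambda>d. \<Sum>k\<in>UNIV. (S1 y - y $ k) * d $ k)) (at y)"
  unfolding G11_def[abs_def] S1_def
  by (auto intro!: derivative_eq_intros vec_nth_has_derivative simp: sum_4 algebra_simps)

lemma pd_G11: "pd k G11 y = S1 y - y $ k"
  by (simp add: pd_eq[OF G11_has_derivative] sum_mult_axis)

lemma open_G11_pos: "open {y. G11 y > 0}"
  unfolding G11_def by (intro open_Collect_less continuous_intros)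

lemma S1_has_derivative: "(S1 has_derivative S1) (at y)"
  unfolding S1_def[abs_def] by (intro derivative_intros vec_nth_has_derivative)

lemma S1_axis: "S1 (axis i 1) = 1"
proof -
  have "S1 (axis i 1) = (\<Sum>k\<in>UNIV. axis i 1 $ k)"
    by (simp add: S1_def sum_4)
  then show ?thesis
    by (simp add: axis_def)
qed

text \<open>These are the entries of J - I, the Hessian of \<open>G11\<close>.\<close>

lemma pd_S1_minus_nth: "pd i (\<lambda>y. S1 y - y $ k) y = (if i = k then 0 else 1)"
  by (subst pd_eq[OF has_derivative_diff[OF S1_has_derivative vec_nth_has_derivative]])
    (simp only: S1_axis, simp add: axis_def)

lemma pd_cmult_G11: "pd k (\<lambda>y. C * G11 y) y = C * (S1 y - y $ k)"
  using G11_has_derivative[of y] by (subst pd_cmult) (auto simp: differentiable_def pd_G11)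

text \<open>Injectivity of J - I: if every coordinate equals the sum of all four, then they are all
  equal to some r with r = 4 r, so r = 0.\<close>

lemma S1_minus_eq_0_iff: "(\<forall>k. S1 w - w $ k = 0) \<longleftrightarrow> w = 0"
  by (auto simp: S1_def vec_eq_iff forall_4)

section \<open>The conformal Minkowski metric\<close>

lemma conformal_minkowski_square:
  assumes "h t > 0" "G11 y > 0"
  shows "(conformal_minkowski h s t x y)\<^sup>2 = exp (2 * s x) / h t * G11 y"
  using assms by (simp add: conformal_minkowski_def power_mult_distrib exp_double)

lemma pd_conformal_minkowski_square:
  assumes "h t > 0" "G11 y > 0"
  shows "pd k (\<lambda>y. (conformal_minkowski h s t x y)\<^sup>2) y = exp (2 * s x) / h t * (S1 y - y $ k)"
proof -
  have "pd k (\<lambda>y. (conformal_minkowski h s t x y)\<^sup>2) y = pd k (\<lambda>y. exp (2 * s x) / h t * G11 y) y"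
    by (rule pd_cong_open[OF open_G11_pos]) (use assms in \<open>auto simp: conformal_minkowski_square\<close>)
  then show ?thesis by (simp only: pd_cmult_G11)
qed

text \<open>The factor \<open>h t\<close> cancels the 1 / \<open>h t\<close> in F^2, so the tensor
  depends on x alone.\<close>

lemma fund_tensor_conformal_minkowski:
  assumes "h t > 0" "G11 y > 0"
  shows "fund_tensor h (conformal_minkowski h s) t x y =
    (\<chi> i j. exp (2 * s x) / 2 * (if i = j then 0 else 1))"
proof -
  have "pd i (\<lambda>y. pd j (\<lambda>y. (conformal_minkowski h s t x y)\<^sup>2) y) y
      = pd i (\<lambda>y. exp (2 * s x) / h t * (S1 y - y $ j)) y" for i j
    by (rule pd_cong_open[OF open_G11_pos])
      (use assms in \<open>auto simp: pd_conformal_minkowski_square\<close>)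
  also have "pd i (\<lambda>y. exp (2 * s x) / h t * (S1 y - y $ j)) y
      = exp (2 * s x) / h t * (if i = j then 0 else 1)" for i j
    using has_derivative_diff[OF S1_has_derivative vec_nth_has_derivative[of j]]
    by (subst pd_cmult) (auto simp: differentiable_def pd_S1_minus_nth)
  finally show ?thesis
    using assms by (simp add: fund_tensor_def)
qed

text \<open>Since J J = 4 J in dimension 4, (J - I)(J/3 - I) = (4/3 - 1 - 1/3) J + I = I.\<close>

lemma fund_tensor_conformal_minkowski_inverse:
  assumes "h t > 0" "G11 y > 0"
  shows "fund_tensor h (conformal_minkowski h s) t x y **
    (\<chi> i j. 2 / exp (2 * s x) * (1 / 3 - (if i = j then 1 else 0))) = mat 1"
  by (simp add: fund_tensor_conformal_minkowski[where h = h, OF assms] matrix_matrix_mult_def mat_def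
      vec_eq_iff forall_4 sum_4)

lemma DERIV_christoffel:
  assumes "h differentiable (at t)" "h t > 0"
  shows "(h has_real_derivative 2 * christoffel h t * h t) (at t)"
  using assms DERIV_deriv_iff_real_differentiable[of h t] by (simp add: christoffel_def)

lemma spatial_spray_conformal_minkowski:
  assumes h: "\<And>t. h t > 0" "h differentiable (at t)"
    and s: "s differentiable (at x)" and y: "G11 y > 0"
  shows "spatial_spray h (conformal_minkowski h s) t x y =
    (\<chi> i. (\<Sum>m\<in>UNIV. pd m s x * y $ m) * y $ i + (pd i s x - 1 / 3 * divD s x) * G11 y)"
proof -
  define E where "E = exp (2 * s x)"
  have E: "E > 0" by (simp add: E_def)
  have ht: "h t > 0" by (rule h)
  have inv: "matrix_inv (fund_tensor h (conformal_minkowski h s) t x y)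
      = (\<chi> i j. 2 / E * (1 / 3 - (if i = j then 1 else 0)))"
    unfolding E_def by (rule matrix_inv_eqI[OF fund_tensor_conformal_minkowski_inverse[where h = h, OF h(1) y]])
  have dx: "pd m (\<lambda>x. exp (2 * s x) / h t * C) x = 2 * E * pd m s x / h t * C" for m C
    using pd_exp[OF s, of m "C / h t"] by (simp add: E_def)
  \<comment> \<open>The relation h' = 2 \<kappa> h, with \<kappa> the Christoffel symbol, turns the
    derivative of 1/h into -2 \<kappa> / h.\<close>
  have dt: "deriv (\<lambda>t. exp (2 * s x) / h t * C) t = - 2 * christoffel h t * E / h t * C" for C
    by (rule DERIV_imp_deriv)
      (use ht in \<open>auto intro!: derivative_eq_intros DERIV_christoffel h simp: E_def field_simps\<close>)
  let ?F = "conformal_minkowski h s"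
  define d where "d = (\<Sum>m\<in>UNIV. pd m s x * y $ m)"
  have fund: "(\<Sum>m\<in>UNIV. fund_tensor h ?F t x y $ k $ m * y $ m) = E / 2 * (S1 y - y $ k)" for k
    using exhaust_4[of k]
    by (auto simp: fund_tensor_conformal_minkowski[where h = h, OF h(1) y] E_def S1_def sum_4 field_simps)
  have mixed: "(\<Sum>m\<in>UNIV. 2 * E * pd m s x / h t * C * y $ m) = 2 * E * d / h t * C" for C
    by (simp add: d_def sum_distrib_left sum_distrib_right sum_divide_distrib mult_ac)
  \<comment> \<open>With p = \<open>S1 y - y $ k\<close>, the last three summands are -2, 1 and 1
    times \<kappa> E p / h, so they add up to zero.\<close>
  have bracket: "(\<Sum>m\<in>UNIV. pd m (\<lambda>x. pd k (\<lambda>y. (?F t x y)\<^sup>2) y) x * y $ m)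
      - pd k (\<lambda>x. (?F t x y)\<^sup>2) x
      + deriv (\<lambda>t. pd k (\<lambda>y. (?F t x y)\<^sup>2) y) t
      + pd k (\<lambda>y. (?F t x y)\<^sup>2) y * christoffel h t
      + 2 * (1 / h t) * christoffel h t * (\<Sum>m\<in>UNIV. fund_tensor h ?F t x y $ k $ m * y $ m)
      = 2 * E / h t * (d * (S1 y - y $ k) - pd k s x * G11 y)" for k
    unfolding fund pd_conformal_minkowski_square[where h = h, OF h(1) y]
      conformal_minkowski_square[where h = h, OF h(1) y] dx dt mixed
    unfolding E_def[symmetric] using ht by (simp add: field_simps)
  have "spatial_spray h ?F t x y $ i
      = (\<Sum>k\<in>UNIV. (1 / 3 - (if i = k then 1 else 0)) * (d * (S1 y - y $ k) - pd k s x * G11 y))" for i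
    unfolding spatial_spray_def inv bracket using ht E by (auto intro!: sum.cong simp: field_simps)
  \<comment> \<open>J/3 - I sends the vector with entries \<open>S1 y - y $ k\<close> back to y, as
    these entries sum to \<open>3 * S1 y\<close>; applied to the gradient of s it produces div/3
    minus the i-th partial derivative.\<close>
  also have "\<dots> i = d * y $ i + (pd i s x - 1 / 3 * divD s x) * G11 y" for i
    using exhaust_4[of i] by (auto simp: sum_4 S1_def divD_def field_simps)
  finally show ?thesis by (simp add: vec_eq_iff d_def)
qed

lemma canonical_connection_conformal_minkowski:
  assumes h: "\<And>t. h t > 0" "h differentiable (at t)"
    and s: "s differentiable (at x)" and y: "G11 y > 0"
  shows "canonical_connection h (conformal_minkowski h s) t x y =
        ((\<chi> i. - christoffel h t * y $ i),
         (\<chi> i j. pd j s x * y $ i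
            + (\<Sum>m\<in>UNIV. pd m s x * y $ m) * (if i = j then 1 else 0)
            + (pd i s x - 1 / 3 * divD s x) * (S1 y - y $ j)))"
proof -
  let ?G = "\<lambda>i y. (\<Sum>m\<in>UNIV. pd m s x * y $ m) * y $ i + (pd i s x - 1 / 3 * divD s x) * G11 y"
  have "pd j (\<lambda>y. spatial_spray h (conformal_minkowski h s) t x y $ i) y = pd j (?G i) y" for i j
    by (rule pd_cong_open[OF open_G11_pos])
      (use y in \<open>auto simp: spatial_spray_conformal_minkowski[where h = h, OF h s]\<close>)
  \<comment> \<open>The product rule gives the derivative as a linear map of the direction; at the
    j-th basis vector its sums collapse to single terms.\<close>
  also have "pd j (?G i) y = pd j s x * y $ i
            + (\<Sum>m\<in>UNIV. pd m s x * y $ m) * (if i = j then 1 else 0)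
            + (pd i s x - 1 / 3 * divD s x) * (S1 y - y $ j)" for i j
    by (subst pd_eq, (rule derivative_eq_intros vec_nth_has_derivative G11_has_derivative refl)+)
      (simp only: sum_mult_axis, simp add: axis_def)
  finally show ?thesis
    by (simp add: canonical_connection_def temporal_spray_def)
qed

section \<open>The Euler-Lagrange equations\<close>

lemma pd_energy_lagrangian:
  assumes "h t > 0" "G11 y > 0"
  shows "pd k (energy_lagrangian h (conformal_minkowski h s) t x) y
    = exp (2 * s x) / h t * sqrt (h t) * (S1 y - y $ k)"
proof -
  have "pd k (energy_lagrangian h (conformal_minkowski h s) t x) y
      = pd k (\<lambda>y. exp (2 * s x) / h t * sqrt (h t) * G11 y) y"
    by (rule pd_cong_open[OF open_G11_pos])
      (use assms in \<open>auto simp: conformal_minkowski_square energy_lagrangian_def\<close>)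
  then show ?thesis by (simp only: pd_cmult_G11)
qed

text \<open>Positivity of \<open>G11\<close> is assumed on a neighbourhood \<open>J\<close> of
  \<open>t\<close>, because the momentum is differentiated in time and its closed form must hold at
  nearby times too.\<close>

lemma euler_lagrange_conformal_minkowski_iff:
  assumes h: "\<And>t. h t > 0" "h differentiable (at t)"
    and s: "s differentiable (at (c t))"
    and J: "open J" "t \<in> J" "\<And>r. r \<in> J \<Longrightarrow> G11 (velocity c r) > 0"
    and c: "c differentiable (at t)" "velocity c differentiable (at t)"
  shows "euler_lagrange_at (energy_lagrangian h (conformal_minkowski h s)) c t \<longleftrightarrow>
        acceleration c t
          + 2 *\<^sub>R temporal_spray h t (c t) (velocity c t)
          + 2 *\<^sub>R spatial_spray h (conformal_minkowski h s) t (c t) (velocity c t) = 0"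
    (is "_ \<longleftrightarrow> ?w = 0")
proof -
  let ?L = "energy_lagrangian h (conformal_minkowski h s)"
  define v where "v = velocity c t"
  define a where "a = acceleration c t"
  define E where "E = exp (2 * s (c t))"
  define d where "d = (\<Sum>m\<in>UNIV. pd m s (c t) * v $ m)"
  \<comment> \<open>The Lagrangian carries h^11 sqrt(h_11) = 1/q; writing h as \<open>q * q\<close>
    makes the later identities rational in q.\<close>
  define q where "q = sqrt (h t)"
  have v: "G11 v > 0" using J by (simp add: v_def)
  have q: "q > 0" "h t = q * q" using h(1)[of t] by (simp_all add: q_def)
  have E: "E > 0" by (simp add: E_def)
  have c': "(c has_derivative (\<lambda>r. r *\<^sub>R v)) (at t)"
    using c(1) by (simp add: v_def velocity_def vector_derivative_works has_vector_derivative_def)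
  have v': "(velocity c has_derivative (\<lambda>r. r *\<^sub>R a)) (at t)"
    using c(2) by (simp add: a_def acceleration_def vector_derivative_works has_vector_derivative_def)
  have vk: "((\<lambda>r. velocity c r $ k) has_real_derivative a $ k) (at t)" for k
    using has_derivative_compose[OF v' vec_nth_has_derivative[of k]]
    by (simp add: has_field_derivative_def mult_commute_abs)
  have sc: "((\<lambda>r. s (c r)) has_real_derivative d) (at t)"
    using has_derivative_compose[OF c' has_derivative_pd[OF s]]
    by (simp add: has_field_derivative_def d_def mult.left_commute mult.commute[of d] mult_commute_abs flip: sum_distrib_left)
  have h': "(h has_real_derivative 2 * christoffel h t * (q * q)) (at t)"
    using DERIV_christoffel[of h t] h q by simp
  have "deriv (\<lambda>r. pd k (\<lambda>y. ?L r (c r) y) (velocity c r)) t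
      = deriv (\<lambda>r. exp (2 * s (c r)) / h r * sqrt (h r) * (S1 (velocity c r) - velocity c r $ k)) t" for k
  proof (rule deriv_cong_ev)
    show "\<forall>\<^sub>F r in nhds t. pd k (\<lambda>y. ?L r (c r) y) (velocity c r)
      = exp (2 * s (c r)) / h r * sqrt (h r) * (S1 (velocity c r) - velocity c r $ k)"
      using eventually_nhds_in_open[OF J(1,2)]
      by eventually_elim (simp add: pd_energy_lagrangian h(1) J(3))
  qed simp
  \<comment> \<open>The logarithmic derivative of E/q along the curve is 2 d - \<kappa>: 2 d comes
    from the exponential, -\<kappa> from 1 / sqrt h.\<close>
  also have "deriv (\<lambda>r. exp (2 * s (c r)) / h r * sqrt (h r) * (S1 (velocity c r) - velocity c r $ k)) t
      = E / q * (S1 a - a $ k + (2 * d - christoffel h t) * (S1 v - v $ k))" for k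
    unfolding S1_def
    apply (rule DERIV_imp_deriv)
    apply (rule derivative_eq_intros sc h' vk refl | (use h(1)[of t] in simp; fail))+
    using q apply (simp flip: E_def q_def v_def)
    apply (simp add: field_simps)
    done
  finally have momentum: "deriv (\<lambda>r. pd k (\<lambda>y. ?L r (c r) y) (velocity c r)) t
      = E / q * (S1 a - a $ k + (2 * d - christoffel h t) * (S1 v - v $ k))" for k .
  have "?L t x v = exp (2 * s x) * (G11 v / q)" for x
    using q v h(1) by (simp add: energy_lagrangian_def conformal_minkowski_square flip: q_def)
  then have force: "pd k (\<lambda>x. ?L t x v) (c t) = E / q * (2 * pd k s (c t) * G11 v)" for k
    by (simp only: pd_exp[OF s], simp add: E_def)
  have w: "?w $ i = a $ i - christoffel h t * v $ i
      + 2 * (d * v $ i + (pd i s (c t) - 1 / 3 * divD s (c t)) * G11 v)" for i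
    by (simp add: spatial_spray_conformal_minkowski[where h = h, OF h s v]
        temporal_spray_def flip: v_def a_def d_def)
  \<comment> \<open>J - I applied to the vector with entries
    \<open>pd i s (c t) - 1 / 3 * divD s (c t)\<close> has k-th entry -div/3 -
    (\<open>pd k s (c t)\<close> - div/3) = -\<open>pd k s (c t)\<close>, which is exactly the force
    term.\<close>
  have balance: "E / q * (S1 a - a $ k + (2 * d - christoffel h t) * (S1 v - v $ k))
      - E / q * (2 * pd k s (c t) * G11 v) = E / q * (S1 ?w - ?w $ k)" for k
  proof -
    have "S1 ?w - ?w $ k = S1 a - a $ k + (2 * d - christoffel h t) * (S1 v - v $ k)
        - 2 * pd k s (c t) * G11 v"
      unfolding S1_def[of ?w] w by (simp add: S1_def divD_def algebra_simps)
    then show ?thesis by (simp add: right_diff_distrib)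
  qed
  have "euler_lagrange_at ?L c t \<longleftrightarrow> (\<forall>k. E / q * (S1 ?w - ?w $ k) = 0)"
    unfolding euler_lagrange_at_def momentum force[unfolded v_def] balance[unfolded v_def] v_def ..
  also have "\<dots> \<longleftrightarrow> (\<forall>k. S1 ?w - ?w $ k = 0)"
    using E q by simp
  finally show ?thesis by (simp only: S1_minus_eq_0_iff)
qed

text \<open>On the real line the velocity is the Frechet derivative in direction 1. The two agree on
  the open set \<open>J\<close>, so the second differentiability demanded by \<open>Ck_on\<close>
  passes to \<open>velocity c\<close>.\<close>

lemma Ck_on_2_velocity:
  assumes "open J" "Ck_on 2 J c" "t \<in> J"
  shows "c differentiable (at t)" "velocity c differentiable (at t)"
proof -
  have d: "c differentiable (at r)" if "r \<in> J" for r
    using assms that by (simp add: numeral_2_eq_2)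
  then show "c differentiable (at t)" using assms by simp
  have "(\<lambda>r. frechet_derivative c (at r) 1) differentiable (at t)"
    using assms by (simp add: numeral_2_eq_2)
  moreover have "frechet_derivative c (at r) 1 = velocity c r" if "r \<in> J" for r
  proof -
    have "(c has_derivative (\<lambda>x. x *\<^sub>R velocity c r)) (at r)"
      using d[OF that] by (simp add: velocity_def vector_derivative_works has_vector_derivative_def)
    then show ?thesis by (simp flip: frechet_derivative_at)
  qed
  ultimately show "velocity c differentiable (at t)"
    using assms by (metis (no_types, lifting) differentiable_def has_derivative_transform_within_open)
qed

theorem proposition2p2:
  fixes M :: "'m topology"
    and A :: "('m, 4) chart set"
    and U :: "'m set" and \<phi> :: "'m \<Rightarrow> real ^ 4"
    and \<sigma> :: "'m \<Rightarrow> real"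
    and h :: "real \<Rightarrow> real"
  assumes "smooth_on UNIV h" and "\<And>t. h t > 0"
    and "smooth_manifold M A"
    and "smooth_function A \<sigma>" and "\<not> \<sigma> constant_on (topspace M)"
    and "(U, \<phi>) \<in> A"
  shows "let s = local_expr (U, \<phi>) \<sigma>; F = conformal_minkowski h s in
    \<comment> \<open>the energy functional and its Euler-Lagrange equations, for \<open>C^2\<close> curves in the chart\<close>
    (\<forall>a b J c. a < b \<and> open J \<and> {a..b} \<subseteq> J \<and> Ck_on 2 J c \<and>
        (\<forall>t\<in>J. c t \<in> \<phi> ` U \<and> G11 (velocity c t) > 0) \<longrightarrow>
      energy h F a b c =
        integral {a..b} (\<lambda>t. exp (2 * s (c t)) * G11 (velocity c t) * (1 / h t) * sqrt (h t)) \<and>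
      (\<forall>t\<in>{a..b}. euler_lagrange_at (energy_lagrangian h F) c t \<longleftrightarrow>
        acceleration c t
          + 2 *\<^sub>R temporal_spray h t (c t) (velocity c t)
          + 2 *\<^sub>R spatial_spray h F t (c t) (velocity c t) = 0)) \<and>
    \<comment> \<open>the canonical nonlinear connection\<close>
    (\<forall>t x y. x \<in> \<phi> ` U \<and> G11 y > 0 \<longrightarrow>
      invertible (fund_tensor h F t x y) \<and>
      canonical_connection h F t x y =
        ((\<chi> i. - christoffel h t * y $ i),
         (\<chi> i j. pd j s x * y $ i
            + (\<Sum>m\<in>UNIV. pd m s x * y $ m) * (if i = j then 1 else 0)
            + (pd i s x - 1 / 3 * divD s x) * (S1 y - y $ j))))"
proof -
  define s where "s = local_expr (U, \<phi>) \<sigma>"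
  have h: "h differentiable (at t)" for t
    using assms(1) by (auto simp: smooth_on_def dest: spec[of _ "Suc 0"])
  have "smooth_on (\<phi> ` U) s"
    using assms(4,6) by (force simp: smooth_function_def s_def)
  then have s: "s differentiable (at x)" if "x \<in> \<phi> ` U" for x
    using that unfolding smooth_on_def by (metis Ck_on.simps(2))
  have en: "energy h (conformal_minkowski h s) a b c =
      integral {a..b} (\<lambda>t. exp (2 * s (c t)) * G11 (velocity c t) * (1 / h t) * sqrt (h t))"
    if "\<And>t. t \<in> {a..b} \<Longrightarrow> G11 (velocity c t) > 0" for a b c
    unfolding energy_def
    by (rule integral_cong) (simp add: energy_lagrangian_def conformal_minkowski_square assms(2) that)
  \<comment> \<open>The explicit inverse certifies that \<open>matrix_inv\<close> in the spray is
    the genuine g^ij and not an arbitrary chosen matrix.\<close>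
  have inv: "invertible (fund_tensor h (conformal_minkowski h s) t x y)" if "G11 y > 0" for t x y
    using fund_tensor_conformal_minkowski_inverse[where h = h, OF assms(2) that]
    by (metis invertible_right_inverse)
  show ?thesis
    unfolding Let_def s_def[symmetric]
    apply (intro conjI allI impI ballI; (elim conjE)?)
    subgoal by (rule en) auto
    subgoal for a b J c t
      by (rule euler_lagrange_conformal_minkowski_iff[where J = J])
        (use assms(2) h s Ck_on_2_velocity[of J c t] in auto)
    subgoal by (rule inv)
    subgoal by (rule canonical_connection_conformal_minkowski[OF assms(2) h s])
    done
qed

end
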